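(* Let $\beta=(\beta_n)_{n\in\mathbb{N}}$ be a stable exponent sequence, $K(a_{n,k})$ a Köthe space, and $\theta=(\theta_t)_{t\ge0}$ a scalar sequence. Then $\hat T_\theta:K(a_{n,k})\to\Lambda_\infty(\beta)$ is compact if and only if $\theta\in\Lambda_\infty(\beta)$ and $$\exists m\in\mathbb{N}\ \forall k\in\mathbb{N}\ \exists C>0\ \ \forall n\ge k:\quad e^{k\beta_n}\le C a_{n,m}.$$
   Context: $\mathbb{N}=\{1,2,3,\dots\}$. A Köthe matrix is a matrix $(a_{n,k})_{n,k\in\mathbb{N}}$ of non-negative numbers such that for each $n$ there is $k$ with $a_{n,k}>0$, and $a_{n,k}\le a_{n,k+1}$ for all $n,k$. The Köthe space is $K(a_{n,k})=\{x=(x_n)_{n\in\mathbb{N}}:\|x\|_k:=\sum_n|x_n|a_{n,k}<\infty\ \forall k\in\mathbb{N}\}$, a Fréchet space with the seminorms $\|\cdot\|_k$. An exponent sequence is a non-negative increasing sequence $\beta=(\beta_n)_{n\in\mathbb{N}}$ with $\beta_n\to\infty$; it is stable if $\sup_n\beta_{2n}/\beta_n<\infty$ (i.e. there is $M$ with $\beta_{2n}\le M\beta_n$ for all $n$). The power series space of infinite type $\Lambda_\infty(\beta)$ is the Köthe space with matrix $(e^{k\beta_n})_{n,k}$. $e_n$ is the sequence with $1$ in the $n$-th place and $0$ elsewhere. A linear map $T:E\to F$ of Fréchet spaces is compact if $T(U)$ is precompact in $F$ for some neighborhood $U$ of zero in $E$. For a sequence $\theta=(\theta_0,\theta_1,\theta_2,\dots)$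 (regarded as an element of a sequence space indexed by $\mathbb{N}$ by letting its $n$-th coordinate be $\theta_{n-1}$), the operator $\hat T_\theta$ given by the lower triangular Toeplitz matrix of $\theta$ is $\hat T_\theta e_n=\sum_{j=n}^\infty\theta_{j-n}e_j$, $\hat T_\theta x=\sum_n x_n\hat T_\theta e_n$ for $x=\sum_n x_ne_n$; it is well-defined if each $\hat T_\theta e_n$ lies in the target space and the series converges there for every $x$ in the domain. Saying that $\hat T_\theta$ is compact includes that it is well-defined. Standing assumption: $\theta_t\ne 0$ for infinitely many $t$. *)

theory Defs
  imports "HOL-Analysis.Analysis"
begin

text \<open>
  The positive integers are the index set throughout. A sequence over them is a function on
  \<^typ>\<open>nat\<close>: elements of a sequence space take the value 0 at the unused index 0, and for
  matrices and exponent sequences the values at index 0 are irrelevant. The scalar field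
  \<open>'a::{real_normed_field, euclidean_space}\<close> stands for the reals or the complex numbers.
\<close>

definition koethe_matrix :: "(nat \<Rightarrow> nat \<Rightarrow> real) \<Rightarrow> bool" where
  "koethe_matrix a \<longleftrightarrow>
     (\<forall>n\<ge>1. \<forall>k\<ge>1. 0 \<le> a n k) \<and>
     (\<forall>n\<ge>1. \<exists>k\<ge>1. 0 < a n k) \<and>
     (\<forall>n\<ge>1. \<forall>k\<ge>1. a n k \<le> a n (k + 1))"

definition koethe_space ::
  "(nat \<Rightarrow> nat \<Rightarrow> real) \<Rightarrow> (nat \<Rightarrow> 'a::{real_normed_field, euclidean_space}) set" where
  "koethe_space a =
     {x. x 0 = 0 \<and> (\<forall>k\<ge>1. (\<lambda>n. norm (x n) * a n k) summable_on {1..})}"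

definition koethe_seminorm ::
  "(nat \<Rightarrow> nat \<Rightarrow> real) \<Rightarrow> nat \<Rightarrow> (nat \<Rightarrow> 'a::{real_normed_field, euclidean_space}) \<Rightarrow> real" where
  "koethe_seminorm a k x = (\<Sum>\<^sub>\<infinity>n\<in>{1..}. norm (x n) * a n k)"

definition koethe_ball ::
  "(nat \<Rightarrow> nat \<Rightarrow> real) \<Rightarrow> nat \<Rightarrow> (nat \<Rightarrow> 'a) \<Rightarrow> real
     \<Rightarrow> (nat \<Rightarrow> 'a::{real_normed_field, euclidean_space}) set" where
  "koethe_ball a k x r =
     {y \<in> koethe_space a. koethe_seminorm a k (\<lambda>n. y n - x n) < r}"

definition koethe_topology ::
  "(nat \<Rightarrow> nat \<Rightarrow> real) \<Rightarrow> (nat \<Rightarrow> 'a::{real_normed_field, euclidean_space}) topology" where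
  "koethe_topology a =
     topology_generated_by {koethe_ball a k x r |k x r. 1 \<le> k \<and> x \<in> koethe_space a \<and> 0 < r}"

lemma topspace_koethe_topology:
  "topspace (koethe_topology a) =
     (koethe_space a :: (nat \<Rightarrow> 'a::{real_normed_field, euclidean_space}) set)"
proof -
  have "x \<in> koethe_ball a 1 x 1" if "x \<in> koethe_space a" for x :: "nat \<Rightarrow> 'a"
    using that by (simp add: koethe_ball_def koethe_seminorm_def)
  then have "x \<in> \<Union>{koethe_ball a k x r |k x r. 1 \<le> k \<and> x \<in> koethe_space a \<and> 0 < r}"
    if "x \<in> koethe_space a" for x :: "nat \<Rightarrow> 'a"
    using that by (intro UnionI[of "koethe_ball a 1 x 1"] CollectI exI[of _ 1] exI[of _ x] conjI) simp_all
  moreover have "koethe_ball a k x r \<subseteq> koethe_space a" for k r and x :: "nat \<Rightarrow> 'a"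
    by (simp add: koethe_ball_def)
  ultimately show ?thesis
    unfolding koethe_topology_def topology_generated_by_topspace by blast
qed

definition exponent_sequence :: "(nat \<Rightarrow> real) \<Rightarrow> bool" where
  "exponent_sequence \<beta> \<longleftrightarrow>
     (\<forall>n\<ge>1. 0 \<le> \<beta> n) \<and> mono_on {1..} \<beta> \<and> filterlim \<beta> at_top sequentially"

definition stable_sequence :: "(nat \<Rightarrow> real) \<Rightarrow> bool" where
  "stable_sequence \<beta> \<longleftrightarrow> (\<exists>M. \<forall>n\<ge>1. \<beta> (2 * n) \<le> M * \<beta> n)"

definition power_series_matrix :: "(nat \<Rightarrow> real) \<Rightarrow> nat \<Rightarrow> nat \<Rightarrow> real" where
  "power_series_matrix \<beta> n k = exp (real k * \<beta> n)"

text \<open>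
  In the following, a topology on (a subset of) \<open>nat \<Rightarrow> 'a\<close> represents a topological vector space
  with pointwise operations, whose underlying set is the \<^const>\<open>topspace\<close>. Precompactness is total
  boundedness for the translation-invariant uniformity.
\<close>

definition zero_neighborhood :: "(nat \<Rightarrow> 'a::real_normed_field) topology \<Rightarrow> (nat \<Rightarrow> 'a) set \<Rightarrow> bool" where
  "zero_neighborhood X U \<longleftrightarrow>
     U \<subseteq> topspace X \<and> (\<exists>W. openin X W \<and> (\<lambda>_. 0) \<in> W \<and> W \<subseteq> U)"

definition precompact_in :: "(nat \<Rightarrow> 'a::real_normed_field) topology \<Rightarrow> (nat \<Rightarrow> 'a) set \<Rightarrow> bool" where
  "precompact_in X A \<longleftrightarrow>
     A \<subseteq> topspace X \<and>
     (\<forall>V. zero_neighborhood X V \<longrightarrow>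
        (\<exists>S. finite S \<and> S \<subseteq> topspace X \<and> A \<subseteq> (\<Union>s\<in>S. (\<lambda>v n. s n + v n) ` V)))"

definition linear_map_between ::
  "(nat \<Rightarrow> 'a::real_normed_field) topology \<Rightarrow> (nat \<Rightarrow> 'a) topology
     \<Rightarrow> ((nat \<Rightarrow> 'a) \<Rightarrow> (nat \<Rightarrow> 'a)) \<Rightarrow> bool" where
  "linear_map_between X Y T \<longleftrightarrow>
     T \<in> topspace X \<rightarrow> topspace Y \<and>
     (\<forall>x\<in>topspace X. \<forall>y\<in>topspace X. T (\<lambda>n. x n + y n) = (\<lambda>n. T x n + T y n)) \<and>
     (\<forall>c. \<forall>x\<in>topspace X. T (\<lambda>n. c * x n) = (\<lambda>n. c * T x n))"

definition compact_linear_map ::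
  "(nat \<Rightarrow> 'a::real_normed_field) topology \<Rightarrow> (nat \<Rightarrow> 'a) topology
     \<Rightarrow> ((nat \<Rightarrow> 'a) \<Rightarrow> (nat \<Rightarrow> 'a)) \<Rightarrow> bool" where
  "compact_linear_map X Y T \<longleftrightarrow>
     linear_map_between X Y T \<and> (\<exists>U. zero_neighborhood X U \<and> precompact_in Y (T ` U))"

text \<open>
  \<open>as_sequence \<theta>\<close> has \<open>n\<close>-th coordinate \<open>\<theta> (n - 1)\<close>, and \<open>toeplitz_column \<theta> n\<close> is the image of the
  \<open>n\<close>-th unit sequence, i.e. the \<open>n\<close>-th column of the lower triangular Toeplitz matrix of \<open>\<theta>\<close>.
\<close>

definition as_sequence :: "(nat \<Rightarrow> 'a::zero) \<Rightarrow> nat \<Rightarrow> 'a" where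
  "as_sequence \<theta> n = (if n = 0 then 0 else \<theta> (n - 1))"

definition toeplitz_column :: "(nat \<Rightarrow> 'a::zero) \<Rightarrow> nat \<Rightarrow> nat \<Rightarrow> 'a" where
  "toeplitz_column \<theta> n j = (if n \<le> j then \<theta> (j - n) else 0)"

definition toeplitz_partial_sum ::
  "(nat \<Rightarrow> 'a::real_normed_field) \<Rightarrow> (nat \<Rightarrow> 'a) \<Rightarrow> nat \<Rightarrow> nat \<Rightarrow> 'a" where
  "toeplitz_partial_sum \<theta> x N j = (\<Sum>n=1..N. x n * toeplitz_column \<theta> n j)"

definition toeplitz_well_defined ::
  "(nat \<Rightarrow> 'a::real_normed_field) topology \<Rightarrow> (nat \<Rightarrow> 'a) topology \<Rightarrow> (nat \<Rightarrow> 'a) \<Rightarrow> bool" where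
  "toeplitz_well_defined X Y \<theta> \<longleftrightarrow>
     (\<forall>n\<ge>1. toeplitz_column \<theta> n \<in> topspace Y) \<and>
     (\<forall>x\<in>topspace X. \<exists>y. limitin Y (toeplitz_partial_sum \<theta> x) y sequentially)"

text \<open>The sum of the series in the target space; meaningful when \<open>Y\<close> is Hausdorff.\<close>

definition toeplitz_operator ::
  "(nat \<Rightarrow> 'a::real_normed_field) topology \<Rightarrow> (nat \<Rightarrow> 'a) \<Rightarrow> (nat \<Rightarrow> 'a) \<Rightarrow> nat \<Rightarrow> 'a" where
  "toeplitz_operator Y \<theta> x = (THE y. limitin Y (toeplitz_partial_sum \<theta> x) y sequentially)"

definition toeplitz_compact ::
  "(nat \<Rightarrow> 'a::real_normed_field) topology \<Rightarrow> (nat \<Rightarrow> 'a) topology \<Rightarrow> (nat \<Rightarrow> 'a) \<Rightarrow> bool" where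
  "toeplitz_compact X Y \<theta> \<longleftrightarrow>
     toeplitz_well_defined X Y \<theta> \<and> compact_linear_map X Y (toeplitz_operator Y \<theta>)"

end

theory Submission
  imports Defs
begin

text \<open>
  Let \<open>\<parallel>x\<parallel>\<^sub>m\<close> be the seminorms of the domain and \<open>p\<^sub>k\<close> those of the power series space.

  Two facts reduce compactness to inequalities. First, a neighbourhood of zero contains a ball of a
  single seminorm, and precompact sets are bounded, so a compact operator \<open>T\<close> admits one index \<open>m\<close>
  such that for every \<open>k\<close> the seminorm \<open>p\<^sub>k\<close> of \<open>T x\<close> is at most a constant times \<open>\<parallel>x\<parallel>\<^sub>m\<close>.
  Conversely such estimates, with \<open>m\<close> independent of \<open>k\<close>, give compactness, because bounded
  sets of a power series space are precompact (\<open>bounded_imp_precompact_power_series\<close>). Second, the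
  seminorms are weighted \<open>l\<^sup>1\<close> norms, so the estimates need only be tested on unit sequences, whose
  images are the columns of the Toeplitz matrix (\<open>toeplitz_image_bounded\<close>). Compactness therefore
  means that for some \<open>m\<close> and all \<open>k\<close> the sum of \<open>\<bar>\<theta> t\<bar> exp (k \<beta> (n + t))\<close> over \<open>t\<close> is at most a
  constant times \<open>a n m\<close>, for all \<open>n\<close>.

  One summand with \<open>\<theta> t \<noteq> 0\<close> already dominates a multiple of \<open>exp (k \<beta> n)\<close>; this, and the fact that
  the first column is \<open>\<theta>\<close> itself, is the necessity (\<open>toeplitz_compact_imp_dominated\<close>). For the
  sufficiency, stability yields a constant \<open>L\<close> with \<open>\<beta> (n + i) \<le> L (\<beta> n + \<beta> i)\<close>, so the sum is at
  most \<open>exp (k L \<beta> n)\<close> times the seminorm of \<open>\<theta>\<close> with index \<open>k L\<close>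
  (\<open>toeplitz_column_estimate\<close>), and the assumed domination with \<open>k L\<close> in place of \<open>k\<close> applies.
\<close>

section \<open>Seminorms of Koethe spaces\<close>

lemma koethe_matrix_nonneg:
  assumes "koethe_matrix a" "1 \<le> k" "1 \<le> n"
  shows "0 \<le> a n k"
  using assms by (simp add: koethe_matrix_def)

lemma koethe_matrix_mono:
  assumes "koethe_matrix a" "1 \<le> k" "k \<le> l" "1 \<le> n"
  shows "a n k \<le> a n l"
  using assms(3)
proof (induction l rule: dec_induct)
  case (step l)
  then have "a n l \<le> a n (l + 1)"
    using assms by (simp add: koethe_matrix_def)
  with step show ?case by simp
qed simp

lemma koethe_spaceD:
  assumes "x \<in> koethe_space a"
  shows "x 0 = 0" "1 \<le> k \<Longrightarrow> (\<lambda>n. norm (x n) * a n k) summable_on {1..}"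
  using assms by (auto simp: koethe_space_def)

lemma koethe_spaceI_bounded:
  fixes x :: "nat \<Rightarrow> 'a::{real_normed_field, euclidean_space}"
  assumes a: "koethe_matrix a" and "x 0 = 0"
    and B: "\<And>k F. 1 \<le> k \<Longrightarrow> finite F \<Longrightarrow> F \<subseteq> {1..} \<Longrightarrow> (\<Sum>n\<in>F. norm (x n) * a n k) \<le> B k"
  shows "x \<in> koethe_space a"
proof -
  have "(\<lambda>n. norm (x n) * a n k) summable_on {1..}" if "1 \<le> k" for k
  proof (rule nonneg_bdd_above_summable_on)
    show "0 \<le> norm (x n) * a n k" if "n \<in> {1..}" for n
      using that \<open>1 \<le> k\<close> koethe_matrix_nonneg[OF a] by simp
    show "bdd_above (sum (\<lambda>n. norm (x n) * a n k) ` {F. F \<subseteq> {1..} \<and> finite F})"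
      using B[OF that] by (auto intro!: bdd_aboveI2[where M = "B k"])
  qed
  with assms(2) show ?thesis by (simp add: koethe_space_def)
qed

lemma koethe_seminorm_leI:
  assumes "x \<in> koethe_space a" "1 \<le> k"
    and "\<And>F. finite F \<Longrightarrow> F \<subseteq> {1..} \<Longrightarrow> (\<Sum>n\<in>F. norm (x n) * a n k) \<le> B"
  shows "koethe_seminorm a k x \<le> B"
  unfolding koethe_seminorm_def
  using assms by (intro infsum_le_finite_sums koethe_spaceD(2)) auto

lemma sum_le_koethe_seminorm:
  assumes "koethe_matrix a" "x \<in> koethe_space a" "1 \<le> k" "finite F" "F \<subseteq> {1..}"
  shows "(\<Sum>n\<in>F. norm (x n) * a n k) \<le> koethe_seminorm a k x"
  unfolding koethe_seminorm_def
  using assms by (intro finite_sum_le_infsum koethe_spaceD(2)) (auto intro!: mult_nonneg_nonneg koethe_matrix_nonneg[OF assms(1)])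

lemma koethe_term_le_seminorm:
  assumes "koethe_matrix a" "x \<in> koethe_space a" "1 \<le> k" "1 \<le> n"
  shows "norm (x n) * a n k \<le> koethe_seminorm a k x"
  using sum_le_koethe_seminorm[of a x k "{n}"] assms by simp

lemma koethe_seminorm_nonneg:
  assumes "koethe_matrix a" "x \<in> koethe_space a" "1 \<le> k"
  shows "0 \<le> koethe_seminorm a k x"
  using sum_le_koethe_seminorm[of a x k "{}"] assms by simp

lemma koethe_seminorm_mono:
  assumes "koethe_matrix a" "x \<in> koethe_space a" "1 \<le> k" "k \<le> l"
  shows "koethe_seminorm a k x \<le> koethe_seminorm a l x"
  unfolding koethe_seminorm_def
  using assms by (intro infsum_mono koethe_spaceD(2))
    (auto intro!: mult_left_mono koethe_matrix_mono)

lemma koethe_add: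
  assumes a: "koethe_matrix a" and x: "x \<in> koethe_space a" and y: "y \<in> koethe_space a"
  shows "(\<lambda>n. x n + y n) \<in> koethe_space a"
    and "1 \<le> k \<Longrightarrow>
      koethe_seminorm a k (\<lambda>n. x n + y n) \<le> koethe_seminorm a k x + koethe_seminorm a k y"
proof -
  have B: "(\<Sum>n\<in>F. norm (x n + y n) * a n k) \<le> koethe_seminorm a k x + koethe_seminorm a k y"
    if F: "1 \<le> k" "finite F" "F \<subseteq> {1..}" for k F
  proof -
    have "(\<Sum>n\<in>F. norm (x n + y n) * a n k) \<le> (\<Sum>n\<in>F. norm (x n) * a n k + norm (y n) * a n k)"
    proof (rule sum_mono)
      fix n assume "n \<in> F"
      then have "0 \<le> a n k" using F koethe_matrix_nonneg[OF a] by auto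
      then have "norm (x n + y n) * a n k \<le> (norm (x n) + norm (y n)) * a n k"
        by (intro mult_right_mono norm_triangle_ineq)
      then show "norm (x n + y n) * a n k \<le> norm (x n) * a n k + norm (y n) * a n k"
        by (simp add: distrib_right)
    qed
    also have "\<dots> \<le> koethe_seminorm a k x + koethe_seminorm a k y"
      unfolding sum.distrib
      using a x y F by (intro add_mono sum_le_koethe_seminorm)
    finally show ?thesis .
  qed
  show sp: "(\<lambda>n. x n + y n) \<in> koethe_space a"
    by (rule koethe_spaceI_bounded[OF a _ B]) (simp_all add: koethe_spaceD(1)[OF x] koethe_spaceD(1)[OF y])
  show "koethe_seminorm a k (\<lambda>n. x n + y n) \<le> koethe_seminorm a k x + koethe_seminorm a k y"
    if "1 \<le> k"
    using koethe_seminorm_leI[OF sp that B[OF that]] .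
qed

lemma koethe_scale:
  assumes "x \<in> koethe_space a"
  shows "(\<lambda>n. c * x n) \<in> koethe_space a"
    and "koethe_seminorm a k (\<lambda>n. c * x n) = norm c * koethe_seminorm a k x"
  using assms by (auto simp: koethe_space_def koethe_seminorm_def norm_mult mult.assoc
      intro!: summable_on_cmult_right infsum_cmult_right')

lemma koethe_diff:
  assumes a: "koethe_matrix a" and x: "x \<in> koethe_space a" and y: "y \<in> koethe_space a"
  shows "(\<lambda>n. x n - y n) \<in> koethe_space a"
    and "koethe_seminorm a k (\<lambda>n. x n - y n) = koethe_seminorm a k (\<lambda>n. y n - x n)"
  using koethe_add(1)[OF a x koethe_scale(1)[OF y, of "-1"]]
  by (simp_all add: koethe_seminorm_def norm_minus_commute)

lemma koethe_zero: "(\<lambda>_. 0) \<in> koethe_space a"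
  by (simp add: koethe_space_def)

lemma koethe_seminorm_zero: "koethe_seminorm a k (\<lambda>_. 0) = 0"
  by (simp add: koethe_seminorm_def)

lemma koethe_finite_support:
  fixes x :: "nat \<Rightarrow> 'a::{real_normed_field, euclidean_space}"
  assumes "finite A" "A \<subseteq> {1..}" "\<And>n. n \<notin> A \<Longrightarrow> x n = 0"
  shows "x \<in> koethe_space a" "koethe_seminorm a k x = (\<Sum>n\<in>A. norm (x n) * a n k)"
proof -
  have hs: "((\<lambda>n. norm (x n) * a n k) has_sum (\<Sum>n\<in>A. norm (x n) * a n k)) {1..}" for k
    using assms by (intro has_sum_finite_neutralI) auto
  have "x 0 = 0" using assms(2,3) by auto
  with hs show "x \<in> koethe_space a"
    by (auto simp: koethe_space_def summable_on_def)
  show "koethe_seminorm a k x = (\<Sum>n\<in>A. norm (x n) * a n k)"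
    unfolding koethe_seminorm_def using hs by (rule infsumI)
qed

text \<open>
  The unit sequences form a Schauder basis: the seminorms of the remainders are the tails of a
  convergent series.
\<close>

lemma koethe_remainder_tendsto_zero:
  assumes a: "koethe_matrix a" and x: "x \<in> koethe_space a" and k: "1 \<le> k"
  shows "(\<lambda>N. koethe_seminorm a k (\<lambda>n. if n \<le> N then 0 else x n)) \<longlonglongrightarrow> 0"
proof -
  let ?g = "\<lambda>n. norm (x n) * a n k"
  have eq: "koethe_seminorm a k (\<lambda>n. if n \<le> N then 0 else x n)
      = koethe_seminorm a k x - sum ?g {1..N}" for N
  proof -
    have "koethe_seminorm a k (\<lambda>n. if n \<le> N then 0 else x n) = infsum ?g ({1..} - {1..N})"
      unfolding koethe_seminorm_def by (rule infsum_cong_neutral) auto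
    also have "\<dots> = infsum ?g {1..} - infsum ?g {1..N}"
      using koethe_spaceD(2)[OF x k] by (intro infsum_Diff) auto
    finally show ?thesis by (simp add: koethe_seminorm_def)
  qed
  have "(?g has_sum koethe_seminorm a k x) {1..}"
    using koethe_spaceD(2)[OF x k] by (simp add: koethe_seminorm_def)
  then have "(sum ?g \<longlongrightarrow> koethe_seminorm a k x) (finite_subsets_at_top {1..})"
    by (simp add: has_sum_def)
  moreover have "filterlim (\<lambda>N. {1..N}) (finite_subsets_at_top {1::nat..}) sequentially"
    unfolding filterlim_finite_subsets_at_top
  proof safe
    fix F :: "nat set" assume F: "finite F" "F \<subseteq> {1..}"
    then have "\<forall>\<^sub>F N in sequentially. Max (insert 0 F) \<le> N"
      by (simp only: eventually_ge_at_top)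
    then show "\<forall>\<^sub>F N in sequentially. finite {1..N} \<and> F \<subseteq> {1..N} \<and> {1..N} \<subseteq> {1..}"
      by eventually_elim (use F in auto)
  qed
  ultimately have "(\<lambda>N. sum ?g {1..N}) \<longlonglongrightarrow> koethe_seminorm a k x"
    by (rule filterlim_compose)
  then have "(\<lambda>N. koethe_seminorm a k x - sum ?g {1..N}) \<longlonglongrightarrow> koethe_seminorm a k x - koethe_seminorm a k x"
    by (intro tendsto_intros)
  then show ?thesis by (simp add: eq)
qed

section \<open>The topology of a Koethe space\<close>

lemma openin_koethe_ball:
  assumes "1 \<le> k" "x \<in> koethe_space a" "0 < r"
  shows "openin (koethe_topology a) (koethe_ball a k x r)"
  unfolding koethe_topology_def
  using assms by (intro topology_generated_by_Basis) blast

lemma koethe_ball_center: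
  assumes "x \<in> koethe_space a" "0 < r"
  shows "x \<in> koethe_ball a k x r"
  using assms by (simp add: koethe_ball_def koethe_seminorm_zero)

text \<open>
  The balls of a single seminorm around a point form a base of its neighbourhoods, rather than only
  a subbase: the seminorms increase with their index, so finitely many balls around a point contain
  a ball of the largest of the seminorms involved.
\<close>

lemma openin_koethe_contains_ball:
  assumes a: "koethe_matrix a" and U: "openin (koethe_topology a) U" and "x \<in> U"
  obtains k r where "1 \<le> k" "0 < r" "koethe_ball a k x r \<subseteq> U"
proof -
  let ?B = "{koethe_ball a k x r |k x r. 1 \<le> k \<and> x \<in> koethe_space a \<and> 0 < r}"
  have "generate_topology_on ?B U"
    using U by (simp add: koethe_topology_def openin_topology_generated_by)
  then have "\<forall>x\<in>U. \<exists>k r. 1 \<le> k \<and> 0 < r \<and> koethe_ball a k x r \<subseteq> U"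
  proof (induction rule: generate_topology_on.induct)
    case (Int U V)
    show ?case
    proof
      fix x assume "x \<in> U \<inter> V"
      with Int obtain k r l s where
        kr: "1 \<le> k" "0 < r" "koethe_ball a k x r \<subseteq> U" and
        ls: "1 \<le> l" "0 < s" "koethe_ball a l x s \<subseteq> V" by blast
      have "x \<in> koethe_space a"
        using \<open>x \<in> U \<inter> V\<close> openin_subset[of "koethe_topology a" U] Int.hyps(1)
        unfolding topspace_koethe_topology
        by (auto simp: koethe_topology_def openin_topology_generated_by_iff)
      have "koethe_ball a (max k l) x (min r s) \<subseteq> koethe_ball a k x r \<inter> koethe_ball a l x s"
      proof
        fix y assume "y \<in> koethe_ball a (max k l) x (min r s)"
        then have y: "y \<in> koethe_space a" "koethe_seminorm a (max k l) (\<lambda>n. y n - x n) < min r s"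
          by (auto simp: koethe_ball_def)
        have d: "(\<lambda>n. y n - x n) \<in> koethe_space a"
          using koethe_diff(1)[OF a] y(1) \<open>x \<in> koethe_space a\<close> by blast
        from koethe_seminorm_mono[OF a d kr(1), of "max k l"]
          koethe_seminorm_mono[OF a d ls(1), of "max k l"] y
        show "y \<in> koethe_ball a k x r \<inter> koethe_ball a l x s"
          by (auto simp: koethe_ball_def)
      qed
      with kr ls show "\<exists>k r. 1 \<le> k \<and> 0 < r \<and> koethe_ball a k x r \<subseteq> U \<inter> V"
        by (intro exI[of _ "max k l"] exI[of _ "min r s"]) auto
    qed
  next
    case (UN \<U>)
    show ?case
    proof
      fix x assume "x \<in> \<Union>\<U>"
      then obtain U where U: "U \<in> \<U>" "x \<in> U" by blast
      with UN.IH obtain k r where "1 \<le> k" "0 < r" "koethe_ball a k x r \<subseteq> U" by blast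
      with U(1) show "\<exists>k r. 1 \<le> k \<and> 0 < r \<and> koethe_ball a k x r \<subseteq> \<Union>\<U>" by blast
    qed
  next
    case (Basis V)
    then obtain k z r where V: "V = koethe_ball a k z r"
      and k: "1 \<le> k" and z: "z \<in> koethe_space a" by blast
    show ?case
    proof
      fix x assume "x \<in> V"
      then have x: "x \<in> koethe_space a" "koethe_seminorm a k (\<lambda>n. x n - z n) < r"
        by (auto simp: V koethe_ball_def)
      have "koethe_ball a k x (r - koethe_seminorm a k (\<lambda>n. x n - z n)) \<subseteq> V"
      proof
        fix y assume "y \<in> koethe_ball a k x (r - koethe_seminorm a k (\<lambda>n. x n - z n))"
        then have y: "y \<in> koethe_space a"
          "koethe_seminorm a k (\<lambda>n. y n - x n) + koethe_seminorm a k (\<lambda>n. x n - z n) < r"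
          by (auto simp: koethe_ball_def)
        with koethe_add(2)[OF a koethe_diff(1)[OF a y(1) x(1)] koethe_diff(1)[OF a x(1) z] k]
        show "y \<in> V" by (simp add: V koethe_ball_def)
      qed
      moreover have "0 < r - koethe_seminorm a k (\<lambda>n. x n - z n)"
        using x by simp
      ultimately show "\<exists>k r. 1 \<le> k \<and> 0 < r \<and> koethe_ball a k x r \<subseteq> V"
        using k by blast
    qed
  qed simp
  with \<open>x \<in> U\<close> that show ?thesis by blast
qed

lemma zero_neighborhood_koethe:
  assumes a: "koethe_matrix a"
  shows "zero_neighborhood (koethe_topology a) U \<longleftrightarrow>
    U \<subseteq> koethe_space a \<and> (\<exists>k r. 1 \<le> k \<and> 0 < r \<and> koethe_ball a k (\<lambda>_. 0) r \<subseteq> U)"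
proof
  assume "zero_neighborhood (koethe_topology a) U"
  then obtain W where U: "U \<subseteq> koethe_space a"
    and W: "openin (koethe_topology a) W" "(\<lambda>_. 0) \<in> W" "W \<subseteq> U"
    by (auto simp: zero_neighborhood_def topspace_koethe_topology)
  from openin_koethe_contains_ball[OF a W(1,2)] U W(3)
  show "U \<subseteq> koethe_space a \<and> (\<exists>k r. 1 \<le> k \<and> 0 < r \<and> koethe_ball a k (\<lambda>_. 0) r \<subseteq> U)"
    by (metis order_trans)
next
  assume "U \<subseteq> koethe_space a \<and> (\<exists>k r. 1 \<le> k \<and> 0 < r \<and> koethe_ball a k (\<lambda>_. 0) r \<subseteq> U)"
  then show "zero_neighborhood (koethe_topology a) U"
    unfolding zero_neighborhood_def topspace_koethe_topology
    using openin_koethe_ball[OF _ koethe_zero] koethe_ball_center[OF koethe_zero] by metis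
qed

lemma limitin_koethe:
  assumes a: "koethe_matrix a" and f: "\<And>N. f N \<in> koethe_space a"
  shows "limitin (koethe_topology a) f y sequentially \<longleftrightarrow>
    y \<in> koethe_space a \<and> (\<forall>k\<ge>1. (\<lambda>N. koethe_seminorm a k (\<lambda>n. f N n - y n)) \<longlonglongrightarrow> 0)"
proof safe
  assume lim: "limitin (koethe_topology a) f y sequentially"
  then show y: "y \<in> koethe_space a"
    by (simp add: limitin_def topspace_koethe_topology)
  fix k :: nat assume k: "1 \<le> k"
  show "(\<lambda>N. koethe_seminorm a k (\<lambda>n. f N n - y n)) \<longlonglongrightarrow> 0"
  proof (rule tendstoI)
    fix e :: real assume "0 < e"
    with lim k y have "\<forall>\<^sub>F N in sequentially. f N \<in> koethe_ball a k y e"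
      by (simp add: limitin_def openin_koethe_ball koethe_ball_center)
    then show "\<forall>\<^sub>F N in sequentially. dist (koethe_seminorm a k (\<lambda>n. f N n - y n)) 0 < e"
    proof eventually_elim
      case (elim N)
      with koethe_seminorm_nonneg[OF a koethe_diff(1)[OF a f y] k, of N]
      show ?case by (simp add: koethe_ball_def)
    qed
  qed
next
  assume y: "y \<in> koethe_space a"
    and lim: "\<forall>k\<ge>1. (\<lambda>N. koethe_seminorm a k (\<lambda>n. f N n - y n)) \<longlonglongrightarrow> 0"
  show "limitin (koethe_topology a) f y sequentially"
    unfolding limitin_def topspace_koethe_topology
  proof (intro conjI allI impI y)
    fix U assume "openin (koethe_topology a) U \<and> y \<in> U"
    then obtain k r where kr: "1 \<le> k" "0 < r" "koethe_ball a k y r \<subseteq> U"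
      using openin_koethe_contains_ball[OF a] by metis
    from lim kr have "\<forall>\<^sub>F N in sequentially. koethe_seminorm a k (\<lambda>n. f N n - y n) < r"
      by (intro order_tendstoD(2)[where y = 0]) auto
    then show "\<forall>\<^sub>F N in sequentially. f N \<in> U"
      by eventually_elim (use f kr in \<open>auto simp: koethe_ball_def\<close>)
  qed
qed

text \<open>
  Koethe spaces are Hausdorff because every row of the matrix has a positive entry: convergence in
  the corresponding seminorm forces convergence of that coordinate.
\<close>

lemma limitin_koethe_unique:
  fixes f :: "nat \<Rightarrow> nat \<Rightarrow> 'a::{real_normed_field, euclidean_space}"
  assumes a: "koethe_matrix a" and f: "\<And>N. f N \<in> koethe_space a"
    and y: "limitin (koethe_topology a) f y sequentially"
    and z: "limitin (koethe_topology a) f z sequentially"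
  shows "y = z"
proof
  have coord: "(\<lambda>N. f N n) \<longlonglongrightarrow> w n"
    if w: "limitin (koethe_topology a) f w sequentially" and n: "1 \<le> n" for w n
  proof -
    obtain k where k: "1 \<le> k" "0 < a n k"
      using a n by (auto simp: koethe_matrix_def)
    have ws: "w \<in> koethe_space a" and lim: "(\<lambda>N. koethe_seminorm a k (\<lambda>n. f N n - w n)) \<longlonglongrightarrow> 0"
      using w k limitin_koethe[OF a f] by auto
    have "norm (f N n - w n) \<le> koethe_seminorm a k (\<lambda>n. f N n - w n) / a n k" for N
      using koethe_term_le_seminorm[OF a koethe_diff(1)[OF a f ws] k(1) n, of N] k(2)
      by (simp add: pos_le_divide_eq)
    moreover have "(\<lambda>N. koethe_seminorm a k (\<lambda>n. f N n - w n) / a n k) \<longlonglongrightarrow> 0"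
      using tendsto_divide[OF lim tendsto_const, of "a n k"] k by simp
    ultimately have "(\<lambda>N. f N n - w n) \<longlonglongrightarrow> 0"
      by (rule Lim_null_comparison[OF always_eventually, OF allI])
    then show ?thesis by (simp add: LIM_zero_iff)
  qed
  fix n
  show "y n = z n"
  proof (cases "1 \<le> n")
    case True
    show ?thesis by (rule LIMSEQ_unique[OF coord[OF y True] coord[OF z True]])
  next
    case False
    moreover have "y \<in> koethe_space a" "z \<in> koethe_space a"
      using y z by (simp_all add: limitin_def topspace_koethe_topology)
    ultimately show ?thesis
      using koethe_spaceD(1)[of y a] koethe_spaceD(1)[of z a] by (simp add: not_le)
  qed
qed

lemma precompact_koethe_bounded:
  fixes A :: "(nat \<Rightarrow> 'a::{real_normed_field, euclidean_space}) set"
  assumes a: "koethe_matrix a" and A: "precompact_in (koethe_topology a) A" and k: "1 \<le> k"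
  obtains R where "\<And>y. y \<in> A \<Longrightarrow> koethe_seminorm a k y \<le> R"
proof -
  let ?V = "koethe_ball a k (\<lambda>_. 0) 1 :: (nat \<Rightarrow> 'a) set"
  have "?V \<subseteq> koethe_space a"
    by (auto simp: koethe_ball_def)
  then have "zero_neighborhood (koethe_topology a) ?V"
    unfolding zero_neighborhood_koethe[OF a] using k by (auto intro!: exI[of _ k] exI[of _ "1::real"])
  then obtain S where S: "finite S" "S \<subseteq> koethe_space a" "A \<subseteq> (\<Union>s\<in>S. (\<lambda>v n. s n + v n) ` ?V)"
    using A unfolding precompact_in_def topspace_koethe_topology by blast
  show thesis
  proof
    fix y assume "y \<in> A"
    then obtain s v where sv: "s \<in> S" "v \<in> koethe_space a" "koethe_seminorm a k v < 1"
      and y: "y = (\<lambda>n. s n + v n)"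
      using S(3) by (auto simp: koethe_ball_def)
    have "koethe_seminorm a k y \<le> koethe_seminorm a k s + koethe_seminorm a k v"
      unfolding y using S(2) sv k by (intro koethe_add(2)[OF a]) auto
    also have "koethe_seminorm a k s \<le> (\<Sum>s\<in>S. koethe_seminorm a k s)"
      using S sv k by (intro member_le_sum) (auto intro!: koethe_seminorm_nonneg[OF a])
    finally show "koethe_seminorm a k y \<le> (\<Sum>s\<in>S. koethe_seminorm a k s) + 1"
      using sv(3) by simp
  qed
qed

section \<open>Power series spaces of infinite type\<close>

lemma exponent_sequence_nonneg: "exponent_sequence \<beta> \<Longrightarrow> 1 \<le> n \<Longrightarrow> 0 \<le> \<beta> n"
  by (simp add: exponent_sequence_def)

lemma exponent_sequence_mono: "exponent_sequence \<beta> \<Longrightarrow> 1 \<le> m \<Longrightarrow> m \<le> n \<Longrightarrow> \<beta> m \<le> \<beta> n"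
  by (auto simp: exponent_sequence_def mono_on_def)

lemma koethe_matrix_power_series:
  assumes "exponent_sequence \<beta>"
  shows "koethe_matrix (power_series_matrix \<beta>)"
  unfolding koethe_matrix_def power_series_matrix_def
  using exponent_sequence_nonneg[OF assms] by (auto intro!: mult_right_mono exI[of _ 1])

text \<open>
  Power series spaces are Montel spaces. On a bounded set the \<open>k\<close>-th seminorms of the remainders
  are uniformly small, because the weight of the seminorm with index \<open>k + 1\<close> exceeds that of the
  \<open>k\<close>-th one by the factor \<open>exp (\<beta> n)\<close>, which tends to infinity; finitely many coordinates range
  over a bounded subset of a finite-dimensional space.
\<close>

lemma bounded_imp_precompact_power_series:
  fixes A :: "(nat \<Rightarrow> 'a::{real_normed_field, euclidean_space}) set"
  assumes \<beta>: "exponent_sequence \<beta>" and A: "A \<subseteq> koethe_space (power_series_matrix \<beta>)"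
    and bounded: "\<And>k y. 1 \<le> k \<Longrightarrow> y \<in> A \<Longrightarrow> koethe_seminorm (power_series_matrix \<beta>) k y \<le> R k"
  shows "precompact_in (koethe_topology (power_series_matrix \<beta>)) A"
  unfolding precompact_in_def topspace_koethe_topology
proof (intro conjI allI impI A)
  let ?b = "power_series_matrix \<beta>"
  note b = koethe_matrix_power_series[OF \<beta>]
  fix V :: "(nat \<Rightarrow> 'a) set"
  assume "zero_neighborhood (koethe_topology ?b) V"
  then obtain k r where k: "1 \<le> k" and r: "0 < r" and V: "koethe_ball ?b k (\<lambda>_. 0) r \<subseteq> V"
    unfolding zero_neighborhood_koethe[OF b] by blast
  define Q where "Q = max 1 (R (k + 1))"
  have "\<forall>\<^sub>F N in sequentially. ln (2 * Q / r) < \<beta> N"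
    using \<beta> unfolding exponent_sequence_def by (simp add: filterlim_at_top_dense)
  then obtain N where N: "1 \<le> N" "ln (2 * Q / r) < \<beta> N"
    by (metis eventually_sequentially nle_le)
  \<comment> \<open>Beyond \<open>N\<close> the ratio of consecutive weights is at least \<open>2 * Q / r\<close>, so the remainders
    contribute at most \<open>r / 2\<close>.\<close>
  have weight: "?b n k \<le> r / (2 * Q) * ?b n (k + 1)" if "N < n" for n
  proof -
    have "2 * Q / r = exp (ln (2 * Q / r))"
      using r by (simp add: Q_def)
    also have "\<dots> \<le> exp (\<beta> n)"
      using N exponent_sequence_mono[OF \<beta>, of N n] that by simp
    finally have "2 * Q / r * exp (real k * \<beta> n) \<le> exp (\<beta> n) * exp (real k * \<beta> n)"
      by (rule mult_right_mono) simp
    also have "\<dots> = ?b n (k + 1)"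
      by (simp add: power_series_matrix_def exp_add [symmetric] algebra_simps)
    finally show ?thesis
      using r by (simp add: power_series_matrix_def Q_def field_simps)
  qed
  define W where "W = 1 + (\<Sum>n\<in>{1..N}. ?b n k)"
  have b_nonneg: "0 \<le> ?b n l" for n l
    by (simp add: power_series_matrix_def)
  have W: "0 < W"
    unfolding W_def using sum_nonneg[of "{1..N}" "\<lambda>n. ?b n k"] b_nonneg by (simp add: add_pos_nonneg)
  obtain F where F: "finite F" "cball (0::'a) (R k) \<subseteq> (\<Union>c\<in>F. ball c (r / (2 * W)))"
    using compact_cball[of "0::'a" "R k"] r W
    unfolding compact_eq_totally_bounded by (metis zero_less_divide_iff zero_less_mult_iff zero_less_numeral)
  let ?S = "{s. \<forall>n. (n \<in> {1..N} \<longrightarrow> s n \<in> F) \<and> (n \<notin> {1..N} \<longrightarrow> s n = 0)}"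
  show "\<exists>S. finite S \<and> S \<subseteq> koethe_space ?b \<and> A \<subseteq> (\<Union>s\<in>S. (\<lambda>v n. s n + v n) ` V)"
  proof (intro exI[of _ ?S] conjI)
    show "finite ?S"
      using F by (intro finite_set_of_finite_funs) auto
    show S: "?S \<subseteq> koethe_space ?b"
    proof
      fix s assume "s \<in> ?S"
      then show "s \<in> koethe_space ?b"
        by (intro koethe_finite_support(1)[of "{1..N}"]) simp_all
    qed
    show "A \<subseteq> (\<Union>s\<in>?S. (\<lambda>v n. s n + v n) ` V)"
    proof
      fix y assume y: "y \<in> A"
      have "\<exists>c\<in>F. norm (y n - c) \<le> r / (2 * W)" if "n \<in> {1..N}" for n
      proof -
        have "norm (y n) \<le> norm (y n) * ?b n k"
          using mult_left_mono[of 1 "?b n k" "norm (y n)"] that exponent_sequence_nonneg[OF \<beta>, of n]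
          by (simp add: power_series_matrix_def)
        also have "\<dots> \<le> koethe_seminorm ?b k y"
          using that A y k by (intro koethe_term_le_seminorm[OF b]) auto
        also have "\<dots> \<le> R k" by (rule bounded[OF k y])
        finally have "y n \<in> cball 0 (R k)" by simp
        with F(2) obtain c where "c \<in> F" "y n \<in> ball c (r / (2 * W))" by blast
        then show ?thesis by (auto simp: dist_norm norm_minus_commute intro!: bexI[of _ c])
      qed
      then obtain c where c: "\<And>n. n \<in> {1..N} \<Longrightarrow> c n \<in> F"
        "\<And>n. n \<in> {1..N} \<Longrightarrow> norm (y n - c n) \<le> r / (2 * W)" by metis
      define s where "s n = (if n \<in> {1..N} then c n else 0)" for n
      have s: "s \<in> ?S" using c by (simp add: s_def)
      define v where "v n = y n - s n" for n
      have v: "v \<in> koethe_space ?b"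
        unfolding v_def using koethe_diff(1)[OF b] y A s S by blast
      have vV: "v \<in> V"
      proof -
        have "koethe_seminorm ?b k v \<le> (W - 1) * (r / (2 * W)) + r / 2"
        proof (rule koethe_seminorm_leI[OF v k])
          fix E assume E: "finite E" "E \<subseteq> {1::nat..}"
          have head: "(\<Sum>n\<in>E \<inter> {..N}. norm (v n) * ?b n k) \<le> (W - 1) * (r / (2 * W))"
          proof -
            have "(\<Sum>n\<in>E \<inter> {..N}. norm (v n) * ?b n k) \<le> (\<Sum>n\<in>{1..N}. norm (v n) * ?b n k)"
              using E b_nonneg by (intro sum_mono2) auto
            also have "\<dots> \<le> (\<Sum>n\<in>{1..N}. r / (2 * W) * ?b n k)"
              using c(2) b_nonneg by (intro sum_mono mult_right_mono) (auto simp: v_def s_def)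
            also have "\<dots> = (W - 1) * (r / (2 * W))"
              by (simp only: sum_distrib_left[symmetric] W_def) simp
            finally show ?thesis .
          qed
          have tail: "(\<Sum>n\<in>E - {..N}. norm (v n) * ?b n k) \<le> r / 2"
          proof -
            have "(\<Sum>n\<in>E - {..N}. norm (v n) * ?b n k)
                \<le> (\<Sum>n\<in>E - {..N}. r / (2 * Q) * (norm (y n) * ?b n (k + 1)))"
            proof (rule sum_mono)
              fix n assume "n \<in> E - {..N}"
              then have "v n = y n" "N < n" by (auto simp: v_def s_def)
              with mult_left_mono[OF weight, of n "norm (y n)"]
              show "norm (v n) * ?b n k \<le> r / (2 * Q) * (norm (y n) * ?b n (k + 1))"
                by (simp add: mult_ac)
            qed
            also have "\<dots> = r / (2 * Q) * (\<Sum>n\<in>E - {..N}. norm (y n) * ?b n (k + 1))"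
              by (rule sum_distrib_left[symmetric])
            also have "\<dots> \<le> r / (2 * Q) * Q"
            proof (rule mult_left_mono)
              have "(\<Sum>n\<in>E - {..N}. norm (y n) * ?b n (k + 1)) \<le> koethe_seminorm ?b (k + 1) y"
                using E y A by (intro sum_le_koethe_seminorm[OF b]) auto
              also have "\<dots> \<le> Q"
                using bounded[of "k + 1" y] y by (simp add: Q_def)
              finally show "(\<Sum>n\<in>E - {..N}. norm (y n) * ?b n (k + 1)) \<le> Q" .
              show "0 \<le> r / (2 * Q)"
                using r by (simp add: Q_def)
            qed
            also have "\<dots> = r / 2"
              by (simp add: Q_def)
            finally show ?thesis .
          qed
          show "(\<Sum>n\<in>E. norm (v n) * ?b n k) \<le> (W - 1) * (r / (2 * W)) + r / 2"
            using sum.Int_Diff[OF E(1), of "\<lambda>n. norm (v n) * ?b n k" "{..N}"] head tail by simp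
        qed
        also have "\<dots> < r"
          using r W by (simp add: field_simps)
        finally show ?thesis
          using V v by (auto simp: koethe_ball_def)
      qed
      have "y = (\<lambda>n. s n + v n)" by (simp add: v_def)
      with s vV show "y \<in> (\<Union>s\<in>?S. (\<lambda>v n. s n + v n) ` V)" by blast
    qed
  qed
qed

text \<open>
  Stability enters only here: of two positive indices \<open>n\<close> and \<open>i\<close> the larger one is at least half
  of their sum, so the exponents of the sum are controlled by those of the summands.
\<close>

lemma stable_sequence_add_le:
  assumes \<beta>: "exponent_sequence \<beta>" and "stable_sequence \<beta>"
  obtains L :: nat where "1 \<le> L" "\<And>n i. 1 \<le> n \<Longrightarrow> 1 \<le> i \<Longrightarrow> \<beta> (n + i) \<le> real L * (\<beta> n + \<beta> i)"
proof -
  obtain M where M: "\<And>n. 1 \<le> n \<Longrightarrow> \<beta> (2 * n) \<le> M * \<beta> n"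
    using assms(2) by (auto simp: stable_sequence_def)
  obtain L :: nat where L: "max 1 M \<le> real L"
    using real_arch_simple by blast
  show thesis
  proof
    show "1 \<le> L" using L by simp
    fix n i :: nat assume ni: "1 \<le> n" "1 \<le> i"
    have "\<beta> (n + i) \<le> \<beta> (2 * max n i)"
      using ni by (intro exponent_sequence_mono[OF \<beta>]) auto
    also have "\<dots> \<le> M * \<beta> (max n i)"
      using ni by (intro M) auto
    also have "\<dots> \<le> real L * (\<beta> n + \<beta> i)"
    proof (rule mult_mono)
      show "M \<le> real L" "0 \<le> real L" using L by simp_all
      show "0 \<le> \<beta> (max n i)" "\<beta> (max n i) \<le> \<beta> n + \<beta> i"
        using ni exponent_sequence_nonneg[OF \<beta>] by (simp_all add: max_def)
    qed
    finally show "\<beta> (n + i) \<le> real L * (\<beta> n + \<beta> i)" .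
  qed
qed

section \<open>Toeplitz operators\<close>

text \<open>
  Coordinates of the image stabilise: the \<open>j\<close>-th one involves only the first \<open>j\<close> columns. This gives
  an explicit formula for the only possible sum of the series.
\<close>

definition toeplitz_image :: "(nat \<Rightarrow> 'a::real_normed_field) \<Rightarrow> (nat \<Rightarrow> 'a) \<Rightarrow> nat \<Rightarrow> 'a" where
  "toeplitz_image \<theta> x j = (\<Sum>n=1..j. x n * toeplitz_column \<theta> n j)"

lemma toeplitz_partial_sum_in_koethe:
  assumes "koethe_matrix b" "\<And>n. 1 \<le> n \<Longrightarrow> toeplitz_column \<theta> n \<in> koethe_space b"
  shows "toeplitz_partial_sum \<theta> x N \<in> koethe_space b"
proof (induction N)
  case 0
  have "toeplitz_partial_sum \<theta> x 0 = (\<lambda>_. 0)"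
    by (simp add: toeplitz_partial_sum_def fun_eq_iff)
  then show ?case by (simp add: koethe_zero)
next
  case (Suc N)
  have "toeplitz_partial_sum \<theta> x (Suc N)
      = (\<lambda>j. toeplitz_partial_sum \<theta> x N j + x (Suc N) * toeplitz_column \<theta> (Suc N) j)"
    by (simp add: toeplitz_partial_sum_def fun_eq_iff)
  with Suc show ?case
    using assms by (auto intro!: koethe_add(1) koethe_scale(1))
qed

lemma toeplitz_operator_eq:
  fixes \<theta> :: "nat \<Rightarrow> 'a::{real_normed_field, euclidean_space}"
  assumes b: "koethe_matrix b" and col: "\<And>n. 1 \<le> n \<Longrightarrow> toeplitz_column \<theta> n \<in> koethe_space b"
    and y: "limitin (koethe_topology b) (toeplitz_partial_sum \<theta> x) y sequentially"
  shows "toeplitz_operator (koethe_topology b) \<theta> x = y"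
  unfolding toeplitz_operator_def
  by (rule the_equality[where P = "\<lambda>y. limitin (koethe_topology b) (toeplitz_partial_sum \<theta> x) y sequentially", OF y
        limitin_koethe_unique[OF b toeplitz_partial_sum_in_koethe[OF b col] _ y]])

lemma toeplitz_operator_scaled_unit:
  fixes \<theta> :: "nat \<Rightarrow> 'a::{real_normed_field, euclidean_space}"
  assumes b: "koethe_matrix b" and col: "\<And>n. 1 \<le> n \<Longrightarrow> toeplitz_column \<theta> n \<in> koethe_space b"
    and n: "1 \<le> n"
  shows "toeplitz_operator (koethe_topology b) \<theta> (\<lambda>i. if i = n then c else 0)
    = (\<lambda>j. c * toeplitz_column \<theta> n j)"
proof (rule toeplitz_operator_eq[OF b col])
  have "\<forall>\<^sub>F N in sequentially. toeplitz_partial_sum \<theta> (\<lambda>i. if i = n then c else 0) N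
      = (\<lambda>j. c * toeplitz_column \<theta> n j)"
    using eventually_ge_at_top[of n]
  proof eventually_elim
    case (elim N)
    have "(\<Sum>i=1..N. (if i = n then c else 0) * toeplitz_column \<theta> i j) = c * toeplitz_column \<theta> n j" for j
      using n elim by (simp add: if_distrib[of "\<lambda>z. z * _"] cong: if_cong)
    then show ?case by (simp add: toeplitz_partial_sum_def fun_eq_iff)
  qed
  moreover have "(\<lambda>j. c * toeplitz_column \<theta> n j) \<in> koethe_space b"
    using col n by (intro koethe_scale(1)) auto
  ultimately show "limitin (koethe_topology b) (toeplitz_partial_sum \<theta> (\<lambda>i. if i = n then c else 0))
      (\<lambda>j. c * toeplitz_column \<theta> n j) sequentially"
    by (auto simp: limitin_def topspace_koethe_topology elim!: eventually_mono)
qed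

text \<open>
  Since the unit sequences are the extreme directions of a weighted \<open>l\<^sup>1\<close> ball, an estimate on the
  columns alone bounds the operator on the whole space with the same constants.
\<close>

lemma toeplitz_image_bounded:
  fixes \<theta> :: "nat \<Rightarrow> 'a::{real_normed_field, euclidean_space}"
  assumes a: "koethe_matrix a" and b: "koethe_matrix b" and m: "1 \<le> m"
    and col: "\<And>n. 1 \<le> n \<Longrightarrow> toeplitz_column \<theta> n \<in> koethe_space b"
    and C: "\<And>k. 1 \<le> k \<Longrightarrow> 0 \<le> C k"
    and le: "\<And>k n. 1 \<le> k \<Longrightarrow> 1 \<le> n \<Longrightarrow> koethe_seminorm b k (toeplitz_column \<theta> n) \<le> C k * a n m"
    and x: "x \<in> koethe_space a"
  shows "toeplitz_image \<theta> x \<in> koethe_space b"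
    and "1 \<le> k \<Longrightarrow> koethe_seminorm b k (toeplitz_image \<theta> x) \<le> C k * koethe_seminorm a m x"
proof -
  have B: "(\<Sum>j\<in>F. norm (toeplitz_image \<theta> x j) * b j k) \<le> C k * koethe_seminorm a m x"
    if k: "1 \<le> k" and F: "finite F" "F \<subseteq> {1..}" for k F
  proof -
    have bnn: "0 \<le> b j k" if "j \<in> F" for j
      using koethe_matrix_nonneg[OF b k] that F by auto
    have "(\<Sum>j\<in>F. norm (toeplitz_image \<theta> x j) * b j k)
        \<le> (\<Sum>j\<in>F. \<Sum>n=1..Max F. norm (x n) * (norm (toeplitz_column \<theta> n j) * b j k))"
    proof (rule sum_mono)
      fix j assume j: "j \<in> F"
      have "norm (toeplitz_image \<theta> x j) \<le> (\<Sum>n=1..j. norm (x n) * norm (toeplitz_column \<theta> n j))"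
        unfolding toeplitz_image_def by (rule norm_sum[THEN order_trans]) (simp add: norm_mult)
      also have "\<dots> \<le> (\<Sum>n=1..Max F. norm (x n) * norm (toeplitz_column \<theta> n j))"
        using j F by (intro sum_mono2) auto
      finally have "norm (toeplitz_image \<theta> x j) * b j k
          \<le> (\<Sum>n=1..Max F. norm (x n) * norm (toeplitz_column \<theta> n j)) * b j k"
        by (rule mult_right_mono) (rule bnn[OF j])
      then show "norm (toeplitz_image \<theta> x j) * b j k
          \<le> (\<Sum>n=1..Max F. norm (x n) * (norm (toeplitz_column \<theta> n j) * b j k))"
        by (simp add: sum_distrib_right mult.assoc)
    qed
    also have "\<dots> = (\<Sum>n=1..Max F. norm (x n) * (\<Sum>j\<in>F. norm (toeplitz_column \<theta> n j) * b j k))"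
      by (subst sum.swap) (simp add: sum_distrib_left)
    also have "\<dots> \<le> (\<Sum>n=1..Max F. norm (x n) * (C k * a n m))"
    proof (intro sum_mono mult_left_mono norm_ge_zero)
      fix n assume "n \<in> {1..Max F}"
      then show "(\<Sum>j\<in>F. norm (toeplitz_column \<theta> n j) * b j k) \<le> C k * a n m"
        using sum_le_koethe_seminorm[OF b col k F, of n] le[OF k, of n] by auto
    qed
    also have "\<dots> = C k * (\<Sum>n=1..Max F. norm (x n) * a n m)"
      by (simp add: sum_distrib_left mult_ac)
    also have "\<dots> \<le> C k * koethe_seminorm a m x"
      using C[OF k] by (intro mult_left_mono sum_le_koethe_seminorm[OF a x m]) auto
    finally show ?thesis .
  qed
  show sp: "toeplitz_image \<theta> x \<in> koethe_space b"
    by (rule koethe_spaceI_bounded[OF b _ B]) (simp add: toeplitz_image_def)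
  show "koethe_seminorm b k (toeplitz_image \<theta> x) \<le> C k * koethe_seminorm a m x" if "1 \<le> k"
    by (rule koethe_seminorm_leI[OF sp that B[OF that]])
qed

lemma toeplitz_image_is_limit:
  fixes \<theta> :: "nat \<Rightarrow> 'a::{real_normed_field, euclidean_space}"
  assumes a: "koethe_matrix a" and b: "koethe_matrix b" and m: "1 \<le> m"
    and col: "\<And>n. 1 \<le> n \<Longrightarrow> toeplitz_column \<theta> n \<in> koethe_space b"
    and C: "\<And>k. 1 \<le> k \<Longrightarrow> 0 \<le> C k"
    and le: "\<And>k n. 1 \<le> k \<Longrightarrow> 1 \<le> n \<Longrightarrow> koethe_seminorm b k (toeplitz_column \<theta> n) \<le> C k * a n m"
    and x: "x \<in> koethe_space a"
  shows "limitin (koethe_topology b) (toeplitz_partial_sum \<theta> x) (toeplitz_image \<theta> x) sequentially"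
proof -
  note bounded = toeplitz_image_bounded[OF a b m col C le]
  note partial = toeplitz_partial_sum_in_koethe[OF b col]
  define rest where "rest N n = (if n \<le> N then 0 else x n)" for N n :: nat
  have rest: "rest N \<in> koethe_space a" for N
  proof -
    have "(\<lambda>n. if n \<in> {1..N} then x n else 0) \<in> koethe_space a"
      by (rule koethe_finite_support(1)[of "{1..N}"]) auto
    from koethe_diff(1)[OF a x this]
    show ?thesis
      by (rule back_subst[where P = "\<lambda>z. z \<in> koethe_space a"])
        (use koethe_spaceD(1)[OF x] in \<open>auto simp: rest_def fun_eq_iff Suc_le_eq\<close>)
  qed
  \<comment> \<open>The error of a partial sum is the image of the remainder of \<open>x\<close>, so that the bound on the
    operator applies to it.\<close>
  have error: "toeplitz_image \<theta> x j - toeplitz_partial_sum \<theta> x N j = toeplitz_image \<theta> (rest N) j" for N j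
  proof -
    have "toeplitz_partial_sum \<theta> x N j = (\<Sum>n=1..j. (x n - rest N n) * toeplitz_column \<theta> n j)"
      unfolding toeplitz_partial_sum_def
      by (rule sum.mono_neutral_cong) (auto simp: rest_def toeplitz_column_def)
    then show ?thesis
      by (simp add: toeplitz_image_def sum_subtractf[symmetric] left_diff_distrib)
  qed
  have "(\<lambda>N. koethe_seminorm b k (\<lambda>j. toeplitz_partial_sum \<theta> x N j - toeplitz_image \<theta> x j)) \<longlonglongrightarrow> 0"
    if k: "1 \<le> k" for k
  proof -
    have "koethe_seminorm b k (\<lambda>j. toeplitz_partial_sum \<theta> x N j - toeplitz_image \<theta> x j)
        = koethe_seminorm b k (toeplitz_image \<theta> (rest N))" for N
      by (subst koethe_diff(2)[OF b partial bounded(1)[OF _ _ _ _ x]]) (simp_all add: error col C le)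
    moreover have "(\<lambda>N. koethe_seminorm b k (toeplitz_image \<theta> (rest N))) \<longlonglongrightarrow> 0"
    proof (rule tendsto_sandwich[OF _ _ tendsto_const])
      show "\<forall>\<^sub>F N in sequentially. 0 \<le> koethe_seminorm b k (toeplitz_image \<theta> (rest N))"
        by (intro always_eventually allI koethe_seminorm_nonneg[OF b] bounded(1)) (use k rest col C le in auto)
      show "\<forall>\<^sub>F N in sequentially. koethe_seminorm b k (toeplitz_image \<theta> (rest N))
          \<le> C k * koethe_seminorm a m (rest N)"
        by (intro always_eventually allI bounded(2)) (use k rest col C le in auto)
      have "(\<lambda>N. koethe_seminorm a m (rest N)) \<longlonglongrightarrow> 0"
        using koethe_remainder_tendsto_zero[OF a x m] by (simp add: rest_def[abs_def])
      from tendsto_mult_left[OF this, of "C k"]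
      show "(\<lambda>N. C k * koethe_seminorm a m (rest N)) \<longlonglongrightarrow> 0" by simp
    qed
    ultimately show ?thesis by simp
  qed
  moreover have "toeplitz_image \<theta> x \<in> koethe_space b"
    by (rule bounded(1)) (use x col C le in auto)
  ultimately show ?thesis
    by (subst limitin_koethe[OF b]) (use partial in auto)
qed

text \<open>
  A neighbourhood of zero that the operator maps to a bounded set is all that compactness requires,
  since bounded sets of the target are precompact.
\<close>

lemma toeplitz_compactI:
  fixes \<theta> :: "nat \<Rightarrow> 'a::{real_normed_field, euclidean_space}"
  assumes \<beta>: "exponent_sequence \<beta>" and a: "koethe_matrix a" and m: "1 \<le> m"
    and col: "\<And>n. 1 \<le> n \<Longrightarrow> toeplitz_column \<theta> n \<in> koethe_space (power_series_matrix \<beta>)"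
    and C: "\<And>k. 1 \<le> k \<Longrightarrow> 0 \<le> C k"
    and le: "\<And>k n. 1 \<le> k \<Longrightarrow> 1 \<le> n \<Longrightarrow>
      koethe_seminorm (power_series_matrix \<beta>) k (toeplitz_column \<theta> n) \<le> C k * a n m"
  shows "toeplitz_compact (koethe_topology a) (koethe_topology (power_series_matrix \<beta>)) \<theta>"
proof -
  let ?b = "power_series_matrix \<beta>"
  let ?T = "toeplitz_operator (koethe_topology ?b) \<theta>"
  note b = koethe_matrix_power_series[OF \<beta>]
  have bounded: "toeplitz_image \<theta> x \<in> koethe_space ?b"
      "1 \<le> k \<Longrightarrow> koethe_seminorm ?b k (toeplitz_image \<theta> x) \<le> C k * koethe_seminorm a m x"
    if "x \<in> koethe_space a" for x k
    using toeplitz_image_bounded[OF a b m col C le that] by auto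
  have lim: "limitin (koethe_topology ?b) (toeplitz_partial_sum \<theta> x) (toeplitz_image \<theta> x) sequentially"
    if "x \<in> koethe_space a" for x
    using toeplitz_image_is_limit[OF a b m col C le that] .
  have T: "?T x = toeplitz_image \<theta> x" if "x \<in> koethe_space a" for x
    by (rule toeplitz_operator_eq[OF b col lim[OF that]])
  have "toeplitz_well_defined (koethe_topology a) (koethe_topology ?b) \<theta>"
    unfolding toeplitz_well_defined_def topspace_koethe_topology using col lim by blast
  moreover have "linear_map_between (koethe_topology a) (koethe_topology ?b) ?T"
    unfolding linear_map_between_def topspace_koethe_topology
    by (auto simp: T bounded(1) koethe_add(1)[OF a] koethe_scale(1) toeplitz_image_def fun_eq_iff
        distrib_right sum.distrib sum_distrib_left mult.assoc)
  moreover have "zero_neighborhood (koethe_topology a) (koethe_ball a m (\<lambda>_. 0) 1)"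
    unfolding zero_neighborhood_koethe[OF a]
    using m by (auto simp: koethe_ball_def intro!: exI[of _ m] exI[of _ "1::real"])
  moreover have "precompact_in (koethe_topology ?b) (?T ` koethe_ball a m (\<lambda>_. 0) 1)"
  proof (rule bounded_imp_precompact_power_series[OF \<beta>, where R = C])
    show "?T ` koethe_ball a m (\<lambda>_. 0) 1 \<subseteq> koethe_space ?b"
      by (auto simp: koethe_ball_def T bounded(1))
    fix k :: nat and y assume k: "1 \<le> k" and "y \<in> ?T ` koethe_ball a m (\<lambda>_. 0) 1"
    then obtain x where x: "x \<in> koethe_space a" "koethe_seminorm a m x < 1" "y = toeplitz_image \<theta> x"
      by (auto simp: koethe_ball_def T)
    have "C k * koethe_seminorm a m x \<le> C k"
      using x(2) C[OF k] by (simp add: mult_left_le)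
    with bounded(2)[OF x(1) k] show "koethe_seminorm ?b k y \<le> C k"
      by (simp add: x(3))
  qed
  ultimately show ?thesis
    unfolding toeplitz_compact_def compact_linear_map_def by blast
qed

lemma toeplitz_column_one: "toeplitz_column \<theta> 1 = as_sequence \<theta>"
  by (auto simp: toeplitz_column_def as_sequence_def fun_eq_iff)

text \<open>
  Shifting \<open>\<theta>\<close> down by \<open>n - 1\<close> places costs the factor \<open>exp (real (k * L) * \<beta> n)\<close>: the entry of
  row \<open>j\<close> is the coordinate \<open>i = j - n + 1\<close> of \<open>\<theta>\<close>, and \<open>j \<le> n + i\<close>.
\<close>

lemma toeplitz_column_estimate:
  fixes \<theta> :: "nat \<Rightarrow> 'a::{real_normed_field, euclidean_space}"
  assumes \<beta>: "exponent_sequence \<beta>" and L: "1 \<le> L"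
    and add: "\<And>n i. 1 \<le> n \<Longrightarrow> 1 \<le> i \<Longrightarrow> \<beta> (n + i) \<le> real L * (\<beta> n + \<beta> i)"
    and \<theta>: "as_sequence \<theta> \<in> koethe_space (power_series_matrix \<beta>)"
    and n: "1 \<le> n"
  shows "toeplitz_column \<theta> n \<in> koethe_space (power_series_matrix \<beta>)"
    and "1 \<le> k \<Longrightarrow> koethe_seminorm (power_series_matrix \<beta>) k (toeplitz_column \<theta> n)
      \<le> koethe_seminorm (power_series_matrix \<beta>) (k * L) (as_sequence \<theta>) * exp (real (k * L) * \<beta> n)"
proof -
  let ?b = "power_series_matrix \<beta>"
  note b = koethe_matrix_power_series[OF \<beta>]
  have B: "(\<Sum>j\<in>F. norm (toeplitz_column \<theta> n j) * ?b j k)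
      \<le> koethe_seminorm ?b (k * L) (as_sequence \<theta>) * exp (real (k * L) * \<beta> n)"
    if k: "1 \<le> k" and F: "finite F" "F \<subseteq> {1..}" for k F
  proof -
    let ?g = "\<lambda>i. norm (as_sequence \<theta> i) * ?b i (k * L)"
    let ?i = "\<lambda>j. j - n + 1"
    let ?F = "F \<inter> {n..}"
    have "(\<Sum>j\<in>F. norm (toeplitz_column \<theta> n j) * ?b j k)
        = (\<Sum>j\<in>?F. norm (toeplitz_column \<theta> n j) * ?b j k)"
      using F by (intro sum.mono_neutral_right) (auto simp: toeplitz_column_def)
    also have "\<dots> \<le> (\<Sum>j\<in>?F. ?g (?i j) * exp (real (k * L) * \<beta> n))"
    proof (rule sum_mono)
      fix j assume "j \<in> ?F"
      then have j: "n \<le> j" by simp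
      then have "\<beta> j \<le> \<beta> (n + ?i j)"
        using n by (intro exponent_sequence_mono[OF \<beta>]) auto
      also have "\<dots> \<le> real L * (\<beta> n + \<beta> (?i j))"
        using n by (intro add) auto
      finally have "real k * \<beta> j \<le> real k * (real L * (\<beta> n + \<beta> (?i j)))"
        by (rule mult_left_mono) simp
      then have "?b j k \<le> exp (real (k * L) * \<beta> n + real (k * L) * \<beta> (?i j))"
        by (simp add: power_series_matrix_def algebra_simps)
      also have "\<dots> = ?b (?i j) (k * L) * exp (real (k * L) * \<beta> n)"
        by (simp only: exp_add power_series_matrix_def mult.commute)
      finally have "norm (\<theta> (j - n)) * ?b j k
          \<le> norm (\<theta> (j - n)) * (?b (?i j) (k * L) * exp (real (k * L) * \<beta> n))"
        by (rule mult_left_mono) simp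
      then show "norm (toeplitz_column \<theta> n j) * ?b j k \<le> ?g (?i j) * exp (real (k * L) * \<beta> n)"
        using j by (simp add: toeplitz_column_def as_sequence_def mult.assoc)
    qed
    also have "\<dots> = (\<Sum>i\<in>?i ` ?F. ?g i) * exp (real (k * L) * \<beta> n)"
      unfolding sum_distrib_right[symmetric]
      by (subst sum.reindex) (auto simp: inj_on_def)
    also have "\<dots> \<le> koethe_seminorm ?b (k * L) (as_sequence \<theta>) * exp (real (k * L) * \<beta> n)"
      using F k L by (intro mult_right_mono sum_le_koethe_seminorm[OF b \<theta>]) auto
    finally show ?thesis .
  qed
  show sp: "toeplitz_column \<theta> n \<in> koethe_space ?b"
    by (rule koethe_spaceI_bounded[OF b _ B]) (use n in \<open>simp_all add: toeplitz_column_def\<close>)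
  show "koethe_seminorm ?b k (toeplitz_column \<theta> n)
      \<le> koethe_seminorm ?b (k * L) (as_sequence \<theta>) * exp (real (k * L) * \<beta> n)" if "1 \<le> k"
    by (rule koethe_seminorm_leI[OF sp that B[OF that]])
qed

section \<open>The characterisation of compactness\<close>

text \<open>
  The operator is bounded on a ball of some seminorm of the domain, so it may be tested on multiples
  of unit sequences. A single non-zero entry of \<open>\<theta>\<close> bounds the image of a unit sequence from
  below, as the weights increase along the column.
\<close>

lemma toeplitz_compact_imp_dominated:
  fixes \<theta> :: "nat \<Rightarrow> 'a::{real_normed_field, euclidean_space}"
  assumes \<beta>: "exponent_sequence \<beta>" and a: "koethe_matrix a" and t: "\<theta> t \<noteq> 0"
    and compact: "toeplitz_compact (koethe_topology a) (koethe_topology (power_series_matrix \<beta>)) \<theta>"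
  shows "\<exists>m\<ge>1. \<forall>k\<ge>1. \<exists>C>0. \<forall>n\<ge>1. exp (real k * \<beta> n) \<le> C * a n m"
proof -
  let ?b = "power_series_matrix \<beta>"
  let ?T = "toeplitz_operator (koethe_topology ?b) \<theta>"
  note b = koethe_matrix_power_series[OF \<beta>]
  have col: "toeplitz_column \<theta> n \<in> koethe_space ?b" if "1 \<le> n" for n
    using compact that
    by (simp add: toeplitz_compact_def toeplitz_well_defined_def topspace_koethe_topology)
  obtain U where "zero_neighborhood (koethe_topology a) U"
    and U: "precompact_in (koethe_topology ?b) (?T ` U)"
    using compact by (auto simp: toeplitz_compact_def compact_linear_map_def)
  then obtain m d where m: "1 \<le> m" and d: "0 < d" and ball: "koethe_ball a m (\<lambda>_. 0) d \<subseteq> U"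
    unfolding zero_neighborhood_koethe[OF a] by blast
  have "\<exists>C>0. \<forall>n\<ge>1. exp (real k * \<beta> n) \<le> C * a n m" if k: "1 \<le> k" for k
  proof -
    obtain R where R: "\<And>y. y \<in> ?T ` U \<Longrightarrow> koethe_seminorm ?b k y \<le> R"
      using precompact_koethe_bounded[OF b U k] by blast
    define Q where "Q = max 1 R / norm (\<theta> t)"
    have Q: "0 < Q" using t by (simp add: Q_def)
    have bound: "c * exp (real k * \<beta> n) \<le> Q" if n: "1 \<le> n" and c: "0 \<le> c" "c * a n m < d" for n c
    proof -
      define x where "x i = (if i = n then of_real c else 0 :: 'a)" for i
      have "x \<in> koethe_space a" "koethe_seminorm a m x = c * a n m"
        using koethe_finite_support(1)[of "{n}" x a] koethe_finite_support(2)[of "{n}" x a m] n c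
        by (simp_all add: x_def)
      then have "x \<in> U"
        using ball c by (auto simp: koethe_ball_def)
      then have "koethe_seminorm ?b k (?T x) \<le> R"
        using R by blast
      moreover have "?T x = (\<lambda>j. of_real c * toeplitz_column \<theta> n j)"
        unfolding x_def by (rule toeplitz_operator_scaled_unit[OF b col n])
      ultimately have "c * koethe_seminorm ?b k (toeplitz_column \<theta> n) \<le> R"
        using koethe_scale(2)[OF col[OF n]] c by simp
      moreover have "norm (\<theta> t) * exp (real k * \<beta> n) \<le> koethe_seminorm ?b k (toeplitz_column \<theta> n)"
      proof -
        have "norm (\<theta> t) * exp (real k * \<beta> n) \<le> norm (\<theta> t) * ?b (n + t) k"
          using exponent_sequence_mono[OF \<beta> n, of "n + t"]
          by (auto simp: power_series_matrix_def intro!: mult_left_mono)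
        also have "\<dots> \<le> koethe_seminorm ?b k (toeplitz_column \<theta> n)"
          using koethe_term_le_seminorm[OF b col[OF n] k, of "n + t"] n
          by (simp add: toeplitz_column_def)
        finally show ?thesis .
      qed
      then have "c * (norm (\<theta> t) * exp (real k * \<beta> n)) \<le> c * koethe_seminorm ?b k (toeplitz_column \<theta> n)"
        using c by (intro mult_left_mono)
      ultimately show ?thesis
        using t by (simp add: Q_def field_simps)
    qed
    show ?thesis
    proof (intro exI[of _ "2 * Q / d"] conjI allI impI)
      show "0 < 2 * Q / d" using Q d by simp
      fix n :: nat assume n: "1 \<le> n"
      have "a n m \<noteq> 0"
      proof
        \<comment> \<open>Otherwise every multiple of the unit sequence would lie in the ball.\<close>
        assume "a n m = 0"
        then have "2 * Q / exp (real k * \<beta> n) * exp (real k * \<beta> n) \<le> Q"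
          using Q d n by (intro bound) auto
        with Q show False by simp
      qed
      then have pos: "0 < a n m"
        using koethe_matrix_nonneg[OF a m n] by simp
      then have "d / (2 * a n m) * exp (real k * \<beta> n) \<le> Q"
        using d n by (intro bound) auto
      with pos d show "exp (real k * \<beta> n) \<le> 2 * Q / d * a n m"
        by (simp add: field_simps)
    qed
  qed
  with m show ?thesis by blast
qed

text \<open>
  Restricting the estimate to \<open>n \<ge> k\<close> loses nothing: its case \<open>k = 1\<close> makes the column \<open>m\<close> of the
  matrix strictly positive, so the finitely many remaining indices only enlarge the constant.
\<close>

lemma dominated_from_start:
  assumes dom: "\<forall>k\<ge>1. \<exists>C>0. \<forall>n\<ge>k. exp (real k * \<beta> n) \<le> C * a n m" and k: "1 \<le> k"
  obtains C :: real where "0 < C" "\<And>n. 1 \<le> n \<Longrightarrow> exp (real k * \<beta> n) \<le> C * a n m"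
proof -
  have pos: "0 < a n m" if "1 \<le> n" for n
  proof -
    obtain C where C: "0 < C" "\<forall>n\<ge>1. exp (\<beta> n) \<le> C * a n m"
      using spec[OF dom, of 1] by auto
    have "exp (\<beta> n) \<le> C * a n m"
      using C(2) that by simp
    then have "0 < C * a n m"
      using exp_gt_zero[of "\<beta> n"] by linarith
    with C show ?thesis by (simp add: zero_less_mult_iff)
  qed
  obtain C where C: "0 < C" "\<And>n. k \<le> n \<Longrightarrow> exp (real k * \<beta> n) \<le> C * a n m"
    using dom k by blast
  define D where "D = C + (\<Sum>n\<in>{1..<k}. exp (real k * \<beta> n) / a n m)"
  have nn: "0 \<le> exp (real k * \<beta> n) / a n m" if "1 \<le> n" for n
    using pos[OF that] by simp
  have CD: "C \<le> D"
    unfolding D_def using nn by (auto intro!: sum_nonneg)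
  show thesis
  proof
    show "0 < D" using C CD by simp
    fix n :: nat assume n: "1 \<le> n"
    show "exp (real k * \<beta> n) \<le> D * a n m"
    proof (cases "k \<le> n")
      case True
      then have "exp (real k * \<beta> n) \<le> C * a n m" by (rule C)
      also have "\<dots> \<le> D * a n m"
        using CD pos[OF n] by (intro mult_right_mono) auto
      finally show ?thesis .
    next
      case False
      then have "exp (real k * \<beta> n) / a n m \<le> (\<Sum>n\<in>{1..<k}. exp (real k * \<beta> n) / a n m)"
        using n nn by (intro member_le_sum) auto
      then have "exp (real k * \<beta> n) / a n m \<le> D"
        using C by (simp add: D_def)
      then show ?thesis
        using pos[OF n] by (simp add: pos_divide_le_eq)
    qed
  qed
qed

theorem theorem3p7:
  fixes \<beta> :: "nat \<Rightarrow> real"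
    and a :: "nat \<Rightarrow> nat \<Rightarrow> real"
    and \<theta> :: "nat \<Rightarrow> 'a::{real_normed_field, euclidean_space}"
  assumes "exponent_sequence \<beta>"
    and "stable_sequence \<beta>"
    and "koethe_matrix a"
    and "infinite {t. \<theta> t \<noteq> 0}"
  shows "toeplitz_compact (koethe_topology a) (koethe_topology (power_series_matrix \<beta>)) \<theta> \<longleftrightarrow>
    as_sequence \<theta> \<in> koethe_space (power_series_matrix \<beta>) \<and>
    (\<exists>m\<ge>1. \<forall>k\<ge>1. \<exists>C>0. \<forall>n\<ge>k. exp (real k * \<beta> n) \<le> C * a n m)"
    (is "?compact \<longleftrightarrow> ?\<theta> \<and> ?dominated")
proof
  assume compact: ?compact
  then have "toeplitz_column \<theta> 1 \<in> koethe_space (power_series_matrix \<beta>)"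
    unfolding toeplitz_compact_def toeplitz_well_defined_def topspace_koethe_topology by blast
  then have ?\<theta> by (simp only: toeplitz_column_one)
  moreover obtain t where "\<theta> t \<noteq> 0"
    using assms(4) not_finite_existsD by auto
  from toeplitz_compact_imp_dominated[OF assms(1,3) this compact]
  obtain m where m: "1 \<le> m" and dom: "\<forall>k\<ge>1. \<exists>C>0. \<forall>n\<ge>1. exp (real k * \<beta> n) \<le> C * a n m"
    by blast
  have "\<exists>C>0. \<forall>n\<ge>k. exp (real k * \<beta> n) \<le> C * a n m" if k: "1 \<le> k" for k
  proof -
    from dom k obtain C where "0 < C" "\<forall>n\<ge>1. exp (real k * \<beta> n) \<le> C * a n m"
      by blast
    with k show ?thesis by (intro exI[of _ C]) auto
  qed
  with m have ?dominated by blast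
  ultimately show "?\<theta> \<and> ?dominated" ..
next
  assume "?\<theta> \<and> ?dominated"
  then obtain m where \<theta>: ?\<theta> and m: "1 \<le> m"
    and dom: "\<forall>k\<ge>1. \<exists>C>0. \<forall>n\<ge>k. exp (real k * \<beta> n) \<le> C * a n m" by blast
  let ?b = "power_series_matrix \<beta>"
  obtain L where L: "1 \<le> L" "\<And>n i. 1 \<le> n \<Longrightarrow> 1 \<le> i \<Longrightarrow> \<beta> (n + i) \<le> real L * (\<beta> n + \<beta> i)"
    using stable_sequence_add_le[OF assms(1,2)] by blast
  note col = toeplitz_column_estimate[OF assms(1) L \<theta>]
  have "\<exists>C\<ge>0. \<forall>n\<ge>1. koethe_seminorm ?b k (toeplitz_column \<theta> n) \<le> C * a n m" if k: "1 \<le> k" for k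
  proof -
    have kL: "1 \<le> k * L" using k L(1) by simp
    let ?p = "koethe_seminorm ?b (k * L) (as_sequence \<theta>)"
    have p: "0 \<le> ?p"
      by (rule koethe_seminorm_nonneg[OF koethe_matrix_power_series[OF assms(1)] \<theta> kL])
    obtain C where C: "0 < C" "\<And>n. 1 \<le> n \<Longrightarrow> exp (real (k * L) * \<beta> n) \<le> C * a n m"
      using dominated_from_start[where \<beta> = \<beta> and a = a and m = m, OF dom kL] by blast
    have "koethe_seminorm ?b k (toeplitz_column \<theta> n) \<le> ?p * C * a n m" if n: "1 \<le> n" for n
      using col(2)[OF _ _ n k] mult_left_mono[OF C(2)[OF n] p] by (simp add: mult.assoc)
    with p C(1) show ?thesis by (intro exI[of _ "?p * C"]) auto
  qed
  then obtain C where "\<And>k. 1 \<le> k \<Longrightarrow> 0 \<le> C k"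
    "\<And>k n. 1 \<le> k \<Longrightarrow> 1 \<le> n \<Longrightarrow> koethe_seminorm ?b k (toeplitz_column \<theta> n) \<le> C k * a n m"
    by metis
  with m col(1) show ?compact
    by (intro toeplitz_compactI[OF assms(1,3)])
qed

end
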